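(* (1) Let $T$ be a tree with $n$ vertices. Then $s_2(T,1)=2n-1$. (2) Let $C$ be a cycle of order $n$ (so $n\ge 3$). Then $s_2(C,1)=2n$.
   Context: Graphs are finite and simple. $\mathbb{Z}_q$ denotes the cyclic group of order $q$. A $\mathbb{Z}_q$-edge-weighted $K_f$ is the complete graph $K_f$ on $f$ vertices equipped with a weight function $\omega:E(K_f)\to\mathbb{Z}_q$ (arbitrary). The weight of a path is the sum in $\mathbb{Z}_q$ of the weights of its edges. A $t$-subdivision of a graph $H$ is the graph obtained from $H$ by replacing each edge of $H$ by a path (a subdivision path) of length exactly $t+1$ with the same endpoints, where the internal vertices of these paths are new and the paths are pairwise internally disjoint. A $q$-divisible $t$-subdivision of $H$ in a $\mathbb{Z}_q$-edge-weighted $K_f$ is a subgraph of $K_f$ that is a $t$-subdivision of $H$ in which every subdivision path has weight $0$ in $\mathbb{Z}_q$. For positive integers $q\ge 2$ and $t$ with $q\mid (t+1)$, $s_q(H,t)$ denotes the minimum $f$ such that every $\mathbb{Z}_q$-edge-weighted $K_f$ contains a $q$-divisible $t$-subdivision of $H$. Here $q=2$ and $t=1$, so every subdivision path has exactly two edges. *)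

theory Defs
  imports "HOL-Algebra.Elementary_Groups" "HOL-Algebra.FiniteProduct"
begin

record 'a ugraph =
  verts :: "'a set"
  edges :: "'a set set"

definition simple_graph :: "'a ugraph \<Rightarrow> bool" where
  "simple_graph G \<longleftrightarrow> finite (verts G) \<and> (\<forall>e\<in>edges G. e \<subseteq> verts G \<and> card e = 2)"

definition is_subgraph :: "'a ugraph \<Rightarrow> 'a ugraph \<Rightarrow> bool" where
  "is_subgraph S G \<longleftrightarrow>
     simple_graph S \<and> simple_graph G \<and> verts S \<subseteq> verts G \<and> edges S \<subseteq> edges G"

definition complete_graph :: "nat \<Rightarrow> nat ugraph" where
  "complete_graph f = \<lparr>verts = {..<f}, edges = {e. e \<subseteq> {..<f} \<and> card e = 2}\<rparr>"

(* A path is given by its sequence of vertices; a path of length l has l + 1 of them. *)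

definition path_edges :: "'a list \<Rightarrow> 'a set set" where
  "path_edges p = {{p ! i, p ! Suc i} | i. Suc i < length p}"

definition is_path :: "'a ugraph \<Rightarrow> 'a list \<Rightarrow> bool" where
  "is_path G p \<longleftrightarrow>
     p \<noteq> [] \<and> distinct p \<and> set p \<subseteq> verts G \<and> path_edges p \<subseteq> edges G"

definition inner_verts :: "'a list \<Rightarrow> 'a set" where
  "inner_verts p = set (butlast (tl p))"

definition connected_graph :: "'a ugraph \<Rightarrow> bool" where
  "connected_graph G \<longleftrightarrow>
     verts G \<noteq> {} \<and>
     (\<forall>u\<in>verts G. \<forall>v\<in>verts G. \<exists>p. is_path G p \<and> hd p = u \<and> last p = v)"

definition is_cycle :: "'a ugraph \<Rightarrow> bool" where
  "is_cycle C \<longleftrightarrow>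
     (\<exists>p. distinct p \<and> length p \<ge> 3 \<and> verts C = set p \<and>
          edges C = insert {last p, hd p} (path_edges p))"

definition is_tree :: "'a ugraph \<Rightarrow> bool" where
  "is_tree T \<longleftrightarrow>
     simple_graph T \<and> connected_graph T \<and> \<not> (\<exists>C. is_subgraph C T \<and> is_cycle C)"

(* S is a t-subdivision of H, where \<phi> sends a vertex of H to the corresponding
   vertex of S, and P sends an edge of H to the path of S that replaces it. As edges
   are unordered, P e may traverse its path in either direction. *)

definition subdivision_via ::
    "nat \<Rightarrow> 'a ugraph \<Rightarrow> 'b ugraph \<Rightarrow> ('a \<Rightarrow> 'b) \<Rightarrow> ('a set \<Rightarrow> 'b list) \<Rightarrow> bool" where
  "subdivision_via t H S \<phi> P \<longleftrightarrow>
     inj_on \<phi> (verts H) \<and>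
     (\<forall>e\<in>edges H. is_path S (P e) \<and> length (P e) = Suc (t + 1) \<and>
        {hd (P e), last (P e)} = \<phi> ` e \<and> inner_verts (P e) \<inter> \<phi> ` verts H = {}) \<and>
     (\<forall>e\<in>edges H. \<forall>e'\<in>edges H. e \<noteq> e' \<longrightarrow> inner_verts (P e) \<inter> inner_verts (P e') = {}) \<and>
     verts S = \<phi> ` verts H \<union> (\<Union>e\<in>edges H. set (P e)) \<and>
     edges S = (\<Union>e\<in>edges H. path_edges (P e))"

(* integer_mod_group q is written multiplicatively: finprod is the sum in Z_q. *)

definition path_weight :: "nat \<Rightarrow> ('a set \<Rightarrow> int) \<Rightarrow> 'a list \<Rightarrow> int" where
  "path_weight q \<omega> p = finprod (integer_mod_group q) \<omega> (path_edges p)"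

definition edge_weighting :: "nat \<Rightarrow> 'a ugraph \<Rightarrow> ('a set \<Rightarrow> int) \<Rightarrow> bool" where
  "edge_weighting q G \<omega> \<longleftrightarrow> \<omega> \<in> edges G \<rightarrow> carrier (integer_mod_group q)"

definition has_divisible_subdivision ::
    "nat \<Rightarrow> nat \<Rightarrow> 'a ugraph \<Rightarrow> 'b ugraph \<Rightarrow> ('b set \<Rightarrow> int) \<Rightarrow> bool" where
  "has_divisible_subdivision q t H G \<omega> \<longleftrightarrow>
     (\<exists>S \<phi> P. is_subgraph S G \<and> subdivision_via t H S \<phi> P \<and>
        (\<forall>e\<in>edges H. path_weight q \<omega> (P e) = \<one>\<^bsub>integer_mod_group q\<^esub>))"

(* Inf on nat is the minimum of a nonempty set, and Inf {} = 0. Hence s_div q H t = m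
   with m > 0 entails that the minimum exists. *)

definition s_div :: "nat \<Rightarrow> 'a ugraph \<Rightarrow> nat \<Rightarrow> nat" where
  "s_div q H t =
     Inf {f. \<forall>\<omega>. edge_weighting q (complete_graph f) \<omega> \<longrightarrow>
               has_divisible_subdivision q t H (complete_graph f) \<omega>}"

end

theory Submission
  imports Defs
begin

text \<open>
  A weighting of the complete graph in \<open>\<int>\<^sub>2\<close> is a colouring of its edges with two colours, and a
  path with two edges has weight zero iff both edges have the same colour.  So the task is to place
  the vertices of \<open>H\<close>, together with one middle vertex for each edge of \<open>H\<close>, injectively into the
  coloured complete graph such that each middle vertex sees the two ends of its edge in the same
  colour (\<open>mono_embedding\<close>).  The subdivision has \<open>2n - 1\<close> vertices for a tree and \<open>2n\<close> for
  a cycle, which gives the lower bounds; the upper bounds say that a spanning copy always exists.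

  The upper bounds rest on a dichotomy (\<open>join_or_P4\<close>).  Either the vertices split into two nonempty
  parts with all cross edges of one colour, or there are four vertices on which both colour
  classes are paths with three edges.  This is the theorem that a graph without an induced path on
  four vertices, or else its complement, is disconnected.

  Trees are embedded by induction on the number of vertices.  Suppose that the vertices split into
  \<open>A\<close> and \<open>B\<close> with \<open>|B| \<le> |A|\<close>.  Remove \<open>|B|\<close> leaves from the tree, embed the rest inside a
  subset of \<open>A\<close>, and put the leaves back one by one: the new leaf goes to \<open>A\<close> and its middle vertex
  to \<open>B\<close>, which works because all tree vertices are in \<open>A\<close> (\<open>tree_embeds_in_join\<close>).  If there are
  four vertices of the second kind, remove two leaves from the tree and embed the rest outside
  these four; wherever the neighbours of the two leaves went, the four vertices can serve as the
  two leaves and their middle vertices (\<open>P4_two_pairs\<close>, \<open>P4_pending_path\<close>).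

  Cycles come from paths, which are trees.  In a split, a path in \<open>A\<close> is closed to a cycle by
  going back and forth between \<open>B\<close> and what is left of \<open>A\<close>.  In the other case a path spans all
  but the four vertices and one more vertex \<open>e\<close>; a finite check shows that these five vertices close
  it to a cycle, provided that \<open>e\<close> is chosen well (\<open>P4_closes_path\<close>).
\<close>

section \<open>A join or an induced path on four vertices\<close>

text \<open>
  The colour \<open>k\<close> forms the path \<open>p q r s\<close>; the other colour then forms the path \<open>q s p r\<close>.
\<close>

definition colour_P4 :: "('b \<Rightarrow> 'b \<Rightarrow> bool) \<Rightarrow> bool \<Rightarrow> 'b \<Rightarrow> 'b \<Rightarrow> 'b \<Rightarrow> 'b \<Rightarrow> bool" where
  "colour_P4 c k p q r s \<longleftrightarrow> distinct [p, q, r, s] \<and>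
     c p q = k \<and> c q r = k \<and> c r s = k \<and> c p r = (\<not> k) \<and> c q s = (\<not> k) \<and> c p s = (\<not> k)"

definition colour_join :: "('b \<Rightarrow> 'b \<Rightarrow> bool) \<Rightarrow> bool \<Rightarrow> 'b set \<Rightarrow> 'b set \<Rightarrow> bool" where
  "colour_join c k A B \<longleftrightarrow> A \<inter> B = {} \<and> (\<forall>a\<in>A. \<forall>b\<in>B. c a b = k)"

lemma symp_colour: "symp c \<Longrightarrow> c x y = c y x"
  by (auto dest: sympD)

lemma colour_join_swap: "symp c \<Longrightarrow> colour_join c k A B \<Longrightarrow> colour_join c k B A"
  unfolding colour_join_def using symp_colour[of c] by blast

text \<open>
  Induction on the vertices.  Let \<open>A\<close>, \<open>B\<close> be a split of \<open>X\<close> in colour \<open>k\<close>, and let the new vertex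
  \<open>v\<close> see some vertex of \<open>A\<close> in colour \<open>k\<close> (a \<open>v\<close> that sees
  no vertex of \<open>X\<close> in colour \<open>k\<close> splits off itself).  Unless \<open>B\<close> or the set of vertices of \<open>A\<close> that \<open>v\<close>
  sees in colour \<open>k\<close> splits off, there are \<open>z\<close> in \<open>B\<close> and \<open>x\<close>, \<open>x'\<close> in \<open>A\<close> such that \<open>z v x x'\<close>
  is an induced path in the colour other than \<open>k\<close>.
\<close>

lemma join_or_P4:
  assumes "finite X" and "2 \<le> card X" and sym: "symp c"
  shows "(\<exists>k A B. A \<noteq> {} \<and> B \<noteq> {} \<and> A \<union> B = X \<and> colour_join c k A B) \<or>
         (\<exists>k p q r s. {p, q, r, s} \<subseteq> X \<and> colour_P4 c k p q r s)"
  using assms(1,2)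
proof (induction X rule: finite_induct)
  case empty
  then show ?case by simp
next
  case (insert v X)
  show ?case
  proof (cases "2 \<le> card X")
    case False
    then have "card X = 1" using insert by simp
    then obtain y where "X = {y}" by (auto simp: card_1_singleton_iff)
    then have "colour_join c (c v y) {v} X" using insert(2) by (auto simp: colour_join_def)
    moreover have "X \<noteq> {}" using \<open>X = {y}\<close> by simp
    ultimately show ?thesis by blast
  next
    case True
    have joinI: ?thesis
      if "colour_join c k A B" "A \<noteq> {}" "B \<noteq> {}" "A \<union> B = insert v X" for k A B
      using that by (intro disjI1 exI[of _ k] exI[of _ A] exI[of _ B]) simp
    \<comment> \<open>the split of \<open>X\<close> either extends to \<open>v\<close> or yields an induced path through \<open>v\<close>\<close>
    have split: ?thesis if AB: "y \<in> A" "c v y = k" "B \<noteq> {}" "A \<union> B = X" "colour_join c k A B"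
      for y k A B
    proof -
      let ?A1 = "{a \<in> A. c v a = k}"
      have v: "v \<notin> A" "v \<notin> B" using insert(2) AB(4) by auto
      consider "\<forall>z\<in>B. c v z = k"
        | "\<forall>x'\<in>?A1. \<forall>x\<in>A - ?A1. c x' x = k"
        | z x x' where "z \<in> B" "c v z = (\<not> k)" "x' \<in> ?A1" "x \<in> A - ?A1" "c x' x = (\<not> k)"
        by blast
      then show ?thesis
      proof cases
        case 1
        then have "colour_join c k (insert v A) B" using AB v by (auto simp: colour_join_def)
        moreover have "insert v A \<union> B = insert v X" using AB by auto
        moreover have "insert v A \<noteq> {}" by simp
        ultimately show ?thesis using AB(3) joinI[of k "insert v A" B] by simp
      next
        case 2
        have "c a v = k" if "a \<in> ?A1" for a using that symp_colour[OF sym, of a v] by simp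
        moreover have "c a b = k" if "a \<in> ?A1" "b \<in> (A - ?A1) \<union> B" for a b
          using that 2 AB(5) unfolding colour_join_def by blast
        moreover have "?A1 \<inter> insert v ((A - ?A1) \<union> B) = {}"
          using v AB(5) unfolding colour_join_def by blast
        ultimately have "colour_join c k ?A1 (insert v ((A - ?A1) \<union> B))"
          unfolding colour_join_def by blast
        moreover have "?A1 \<union> insert v ((A - ?A1) \<union> B) = insert v X" using AB by auto
        moreover have "?A1 \<noteq> {}" using AB by auto
        moreover have "insert v ((A - ?A1) \<union> B) \<noteq> {}" by simp
        ultimately show ?thesis using joinI[of k ?A1 "insert v ((A - ?A1) \<union> B)"] by simp
      next
        case 3
        have "c z x = k" "c z x' = k" "z \<noteq> x" "z \<noteq> x'"
          using 3 AB(5) symp_colour[OF sym] unfolding colour_join_def by blast+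
        moreover have "c z v = (\<not> k)" "c x x' = (\<not> k)" "c v x = (\<not> k)" "c v x' = k"
          using 3 symp_colour[OF sym, of z v] symp_colour[OF sym, of x x'] by auto
        moreover have "z \<noteq> v" "x \<noteq> v" "x' \<noteq> v" "x \<noteq> x'" using 3 v by auto
        ultimately have "colour_P4 c (\<not> k) z v x x'" unfolding colour_P4_def by simp
        moreover have "{z, v, x, x'} \<subseteq> insert v X" using 3 AB by auto
        ultimately show ?thesis by (intro disjI2 exI conjI)
      qed
    qed
    from insert.IH[OF True] show ?thesis
    proof (elim disjE exE conjE)
      fix k A B
      assume AB: "A \<noteq> {}" "B \<noteq> {}" "A \<union> B = X" "colour_join c k A B"
      show ?thesis
      proof (cases "\<exists>y\<in>X. c v y = k")
        case True
        then obtain y where y: "y \<in> A \<or> y \<in> B" "c v y = k" using AB(3) by blast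
        have BA: "B \<union> A = X" using AB(3) by blast
        from y(1) show ?thesis
        proof
          assume "y \<in> A"
          then show ?thesis by (rule split) (use y AB in simp_all)
        next
          assume "y \<in> B"
          then show ?thesis
            by (rule split) (use y AB BA colour_join_swap[OF sym AB(4)] in simp_all)
        qed
      next
        case False
        then have "colour_join c (\<not> k) {v} X" using insert(2) by (auto simp: colour_join_def)
        moreover have "X \<noteq> {}" using AB by auto
        ultimately show ?thesis using joinI[of "\<not> k" "{v}" X] by simp
      qed
    next
      fix k p q r s
      assume P4: "{p, q, r, s} \<subseteq> X" "colour_P4 c k p q r s"
      then have "{p, q, r, s} \<subseteq> insert v X" by auto
      then show ?thesis using P4(2) by (intro disjI2 exI conjI)
    qed
  qed
qed

lemma colour_P4D:
  assumes "symp c" and "colour_P4 c k p q r s"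
  shows "p \<noteq> q" "p \<noteq> r" "p \<noteq> s" "q \<noteq> r" "q \<noteq> s" "r \<noteq> s"
    and "q \<noteq> p" "r \<noteq> p" "s \<noteq> p" "r \<noteq> q" "s \<noteq> q" "s \<noteq> r"
    and "c p q = k" "c q r = k" "c r s = k" "c p r = (\<not> k)" "c q s = (\<not> k)" "c p s = (\<not> k)"
    and "c q p = k" "c r q = k" "c s r = k" "c r p = (\<not> k)" "c s q = (\<not> k)" "c s p = (\<not> k)"
  using assms(2) symp_colour[OF assms(1), of q p] symp_colour[OF assms(1), of r q]
    symp_colour[OF assms(1), of s r] symp_colour[OF assms(1), of r p]
    symp_colour[OF assms(1), of s q] symp_colour[OF assms(1), of s p]
  unfolding colour_P4_def by auto

lemma join_or_P4_cases:
  assumes "finite X" and "2 \<le> card X" and sym: "symp c"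
  obtains (join) k A B where "A \<union> B = X" "colour_join c k A B" "1 \<le> card B" "card B \<le> card A"
      "card A + card B = card X"
    | (P4) k p q r s where "{p, q, r, s} \<subseteq> X" "colour_P4 c k p q r s"
        "card (X - {p, q, r, s}) + 4 = card X"
proof (cases "\<exists>k p q r s. {p, q, r, s} \<subseteq> X \<and> colour_P4 c k p q r s")
  case True
  then obtain k p q r s where *: "{p, q, r, s} \<subseteq> X" "colour_P4 c k p q r s" by meson
  have "card {p, q, r, s} = 4" using colour_P4D[OF sym *(2)] by simp
  moreover have "card (X - {p, q, r, s}) = card X - card {p, q, r, s}"
    by (rule card_Diff_subset) (use *(1) in simp_all)
  moreover have "card {p, q, r, s} \<le> card X" using card_mono[OF assms(1) *(1)] .
  ultimately have "card (X - {p, q, r, s}) + 4 = card X" by linarith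
  then show ?thesis by (rule P4[OF *])
next
  case False
  then have "\<exists>k A B. A \<noteq> {} \<and> B \<noteq> {} \<and> A \<union> B = X \<and> colour_join c k A B"
    using join_or_P4[OF assms] by argo
  then obtain k A B where AB: "A \<noteq> {}" "B \<noteq> {}" "A \<union> B = X" "colour_join c k A B"
    by (elim exE conjE) (rule that)
  have fin: "finite A" "finite B" using AB(3) assms(1) by auto
  have card: "card A + card B = card X"
    using card_Un_disjoint[OF fin] AB(3,4) by (simp add: colour_join_def)
  have pos: "1 \<le> card A" "1 \<le> card B" using AB(1,2) fin by (simp_all add: Suc_le_eq card_gt_0_iff)
  show ?thesis
  proof (cases "card B \<le> card A")
    case True
    then show ?thesis by (rule join[OF AB(3,4) pos(2) _ card])
  next
    case False
    show ?thesis
      by (rule join[OF _ colour_join_swap[OF sym AB(4)] pos(1)]) (use False card AB(3) in auto)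
  qed
qed

section \<open>What four vertices of this kind can absorb\<close>

text \<open>
  The four vertices extend any embedding by a pendant path \<open>w s1 y1 s2 y2\<close>; the colour of the edge
  between \<open>w\<close> and the end \<open>p\<close> decides between the orders \<open>p q r s\<close> and \<open>p s r q\<close>.
\<close>

lemma P4_pending_path:
  assumes sym: "symp c" and P4: "colour_P4 c k p q r s"
  shows "\<exists>s1 y1 s2 y2. distinct [s1, y1, s2, y2] \<and> {s1, y1, s2, y2} \<subseteq> {p, q, r, s} \<and>
           c s1 w = c s1 y1 \<and> c s2 y1 = c s2 y2"
proof -
  note P = colour_P4D[OF sym P4]
  show ?thesis
  proof (cases "c p w = k")
    case True
    then show ?thesis by (intro exI[of _ p] exI[of _ q] exI[of _ r] exI[of _ s]) (simp add: P)
  next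
    case False
    then show ?thesis by (intro exI[of _ p] exI[of _ s] exI[of _ r] exI[of _ q]) (simp add: P)
  qed
qed

text \<open>
  The four vertices provide a pendant path at each of two given vertices.  There are three ways to
  divide them into two pairs, and two ways to assign the pairs to \<open>w1\<close> and \<open>w2\<close>.  A pair cannot
  be used at \<open>w\<close> only if \<open>w\<close> sees both its vertices in the colour that the pair does not have.
\<close>

lemma P4_two_pairs:
  assumes sym: "symp c" and P4: "colour_P4 c k p q r s"
  shows "\<exists>s1 y1 s2 y2. distinct [s1, y1, s2, y2] \<and> {s1, y1, s2, y2} \<subseteq> {p, q, r, s} \<and>
           c s1 w1 = c s1 y1 \<and> c s2 w2 = c s2 y2" (is "\<exists>s1 y1 s2 y2. ?good s1 y1 s2 y2")
proof (rule ccontr)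
  assume no: "\<not> ?thesis"
  then have no: "\<not> ?good s1 y1 s2 y2" for s1 y1 s2 y2 by meson
  note P = colour_P4D[OF sym P4]
  \<comment> \<open>one failing condition for each of the six assignments of pairs\<close>
  have pairs: "\<not> ((c p w1 = k \<or> c q w1 = k) \<and> (c r w2 = k \<or> c s w2 = k))"
    "\<not> ((c r w1 = k \<or> c s w1 = k) \<and> (c p w2 = k \<or> c q w2 = k))"
    "\<not> ((c p w1 \<noteq> k \<or> c r w1 \<noteq> k) \<and> (c q w2 \<noteq> k \<or> c s w2 \<noteq> k))"
    "\<not> ((c q w1 \<noteq> k \<or> c s w1 \<noteq> k) \<and> (c p w2 \<noteq> k \<or> c r w2 \<noteq> k))"
    "\<not> ((c p w1 \<noteq> k \<or> c s w1 \<noteq> k) \<and> (c q w2 = k \<or> c r w2 = k))"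
    "\<not> ((c q w1 = k \<or> c r w1 = k) \<and> (c p w2 \<noteq> k \<or> c s w2 \<noteq> k))"
    subgoal using no[of p q r s] no[of q p r s] no[of p q s r] no[of q p s r] by (simp add: P) argo
    subgoal using no[of r s p q] no[of r s q p] no[of s r p q] no[of s r q p] by (simp add: P) argo
    subgoal using no[of p r q s] no[of p r s q] no[of r p q s] no[of r p s q] by (simp add: P) argo
    subgoal using no[of q s p r] no[of q s r p] no[of s q p r] no[of s q r p] by (simp add: P) argo
    subgoal using no[of p s q r] no[of p s r q] no[of s p q r] no[of s p r q] by (simp add: P) argo
    subgoal using no[of q r p s] no[of q r s p] no[of r q p s] no[of r q s p] by (simp add: P) argo
    done
  then show False by argo
qed

text \<open>
  Let a spanning path of the remaining vertices end in \<open>w\<close> and \<open>w'\<close>, and let \<open>e\<close> be a fifth vertex.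
  These are the five colour patterns from \<open>e\<close> to \<open>p\<close>, \<open>q\<close>, \<open>r\<close>, \<open>s\<close> for which, with some colours
  at \<open>w\<close> and \<open>w'\<close>, the five vertices do not close the path to a cycle.
\<close>

definition exceptional :: "('b \<Rightarrow> 'b \<Rightarrow> bool) \<Rightarrow> bool \<Rightarrow> 'b \<Rightarrow> 'b \<Rightarrow> 'b \<Rightarrow> 'b \<Rightarrow> 'b \<Rightarrow> bool" where
  "exceptional c k p q r s e \<longleftrightarrow>
     (c p e \<noteq> k \<and> c q e = k \<and> c r e \<noteq> k \<and> c s e \<noteq> k) \<or>
     (c p e \<noteq> k \<and> c q e \<noteq> k \<and> c r e = k \<and> c s e \<noteq> k) \<or>
     (c p e = k \<and> c q e = k \<and> c r e = k \<and> c s e \<noteq> k) \<or>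
     (c p e \<noteq> k \<and> c q e = k \<and> c r e = k \<and> c s e = k) \<or>
     (c p e = k \<and> c q e \<noteq> k \<and> c r e \<noteq> k \<and> c s e = k)"

text \<open>
  If \<open>e\<close> is not exceptional, the path can be closed whatever \<open>w\<close> and \<open>w'\<close> are.  If \<open>e\<close> is
  exceptional, it can still be closed when \<open>w\<close> and \<open>w'\<close> are exceptional as well.  So an \<open>e\<close> that works can always be chosen: one that is not exceptional if it exists, and any vertex
  otherwise.  The five vertices are used in an order \<open>x1 y1 x2 y2 x3\<close> with middle vertices
  \<open>x1\<close>, \<open>x2\<close>, \<open>x3\<close>.
\<close>

lemma P4_closes_path:
  assumes sym: "symp c" and P4: "colour_P4 c k p q r s" and e: "e \<notin> {p, q, r, s}"
    and exc: "exceptional c k p q r s e \<longrightarrow> exceptional c k p q r s w \<and> exceptional c k p q r s w'"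
  shows "\<exists>x1 y1 x2 y2 x3. distinct [x1, y1, x2, y2, x3] \<and> {x1, y1, x2, y2, x3} \<subseteq> {p, q, r, s, e} \<and>
           c x1 w = c x1 y1 \<and> c x2 y1 = c x2 y2 \<and> c x3 y2 = c x3 w'"
    (is "\<exists>x1 y1 x2 y2 x3. ?good x1 y1 x2 y2 x3")
proof (rule ccontr)
  assume "\<not> ?thesis"
  then have no: "\<not> ?good x1 y1 x2 y2 x3" for x1 y1 x2 y2 x3 by meson
  note P = colour_P4D[OF sym P4]
  have E: "e \<noteq> p" "e \<noteq> q" "e \<noteq> r" "e \<noteq> s" "p \<noteq> e" "q \<noteq> e" "r \<noteq> e" "s \<noteq> e" using e by auto
  note S = symp_colour[OF sym, of e p] symp_colour[OF sym, of e q]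
    symp_colour[OF sym, of e r] symp_colour[OF sym, of e s]
  \<comment> \<open>Twenty-three of the 120 orders suffice; together they cover all colours of the edges at
    \<open>e\<close>, \<open>w\<close> and \<open>w'\<close> that the hypothesis admits.  Each fact says that one order fails.\<close>
  have a1: "\<not> ((c p w \<noteq> k) \<and> ((c e w' = k) = (c q e = k)))"
    using no[of p s r q e] by (simp add: P E S) argo?
  have a2: "\<not> ((c p w = k) \<and> ((c e w' = k) = (c s e = k)))"
    using no[of p q r s e] by (simp add: P E S) argo?
  have a3: "\<not> ((c r w = k) \<and> ((c e w' = k) = (c p e = k)))"
    using no[of r q s p e] by (simp add: P E S) argo?
  have a4: "\<not> (((c e w = k) = (c p e = k)) \<and> (c r w' = k))"
    using no[of e p s q r] by (simp add: P E S) argo?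
  have a5: "\<not> (((c e w = k) = (c q e = k)) \<and> (c r w' \<noteq> k))"
    using no[of e q s p r] by (simp add: P E S) argo?
  have a6: "\<not> (((c e w = k) = (c r e = k)) \<and> (c s w' \<noteq> k))"
    using no[of e r q p s] by (simp add: P E S) argo?
  have a7: "\<not> (((c e w = k) = (c s e = k)) \<and> (c q w' = k))"
    using no[of e s p r q] by (simp add: P E S) argo?
  have a8: "\<not> ((c r w \<noteq> k) \<and> ((c p e = k) = (c s e = k)) \<and> (c q w' \<noteq> k))"
    using no[of r p e s q] by (simp add: P E S) argo?
  have a9: "\<not> ((c p w \<noteq> k) \<and> (c s e = k) \<and> ((c q w' = k) = (c q e = k)))"
    using no[of p r s e q] by (simp add: P E S) argo?
  have a10: "\<not> ((c p w = k) \<and> ((c q e = k) = (c r e = k)) \<and> (c s w' = k))"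
    using no[of p q e r s] by (simp add: P E S) argo?
  have a11: "\<not> (((c e w = k) = (c r e = k)) \<and> (c q w' \<noteq> k))"
    using no[of e r p s q] by (simp add: P E S) argo?
  have a12: "\<not> ((c q w = k) \<and> ((c r e = k) = (c p e = k)) \<and> (c s w' \<noteq> k))"
    using no[of q r e p s] by (simp add: P E S) argo?
  have a13: "\<not> ((c p w \<noteq> k) \<and> (c q e \<noteq> k) \<and> ((c r w' = k) = (c r e = k)))"
    using no[of p s q e r] by (simp add: P E S) argo?
  have a14: "\<not> (((c p w = k) = (c p e = k)) \<and> (c q e \<noteq> k) \<and> (c r w' = k))"
    using no[of p e q s r] by (simp add: P E S) argo?
  have a15: "\<not> ((c q w \<noteq> k) \<and> ((c e w' = k) = (c r e = k)))"
    using no[of q s p r e] by (simp add: P E S) argo?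
  have a16: "\<not> ((c r w = k) \<and> ((c q e = k) = (c p e = k)) \<and> (c s w' \<noteq> k))"
    using no[of r q e p s] by (simp add: P E S) argo?
  have a17: "\<not> ((c q w = k) \<and> (c r e \<noteq> k) \<and> ((c s w' = k) = (c s e = k)))"
    using no[of q p r e s] by (simp add: P E S) argo?
  have a18: "\<not> ((c q w = k) \<and> ((c p e = k) = (c r e = k)) \<and> (c s w' = k))"
    using no[of q p e r s] by (simp add: P E S) argo?
  have a19: "\<not> ((c q w \<noteq> k) \<and> ((c s e = k) = (c r e = k)) \<and> (c p w' \<noteq> k))"
    using no[of q s e r p] by (simp add: P E S) argo?
  have a20: "\<not> (((c r w = k) = (c r e = k)) \<and> (c s e \<noteq> k) \<and> (c p w' = k))"
    using no[of r e s q p] by (simp add: P E S) argo?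
  have a21: "\<not> ((c q w \<noteq> k) \<and> (c r e = k) \<and> ((c p w' = k) = (c p e = k)))"
    using no[of q s r e p] by (simp add: P E S) argo?
  have a22: "\<not> (((c p w = k) = (c p e = k)) \<and> (c q e = k) \<and> (c s w' = k))"
    using no[of p e q r s] by (simp add: P E S) argo?
  have a23: "\<not> ((c r w = k) \<and> (c s e \<noteq> k) \<and> ((c p w' = k) = (c p e = k)))"
    using no[of r q s e p] by (simp add: P E S) argo?
  from exc show False unfolding exceptional_def
    using a1 a2 a3 a4 a5 a6 a7 a8 a9 a10 a11 a12 a13 a14 a15 a16 a17 a18 a19 a20 a21 a22 a23
    by argo
qed

section \<open>Spanning embeddings of subdivided trees\<close>

text \<open>
  A subdivision with two-edge paths is recorded by the places \<open>\<phi>\<close> of the vertices and \<open>\<mu>\<close> of the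
  middle vertices of the edges, so that adding a leaf amounts to two function updates.
\<close>

definition mono_embedding ::
    "('b \<Rightarrow> 'b \<Rightarrow> bool) \<Rightarrow> 'a set \<Rightarrow> 'a set set \<Rightarrow> 'b set \<Rightarrow> ('a \<Rightarrow> 'b) \<Rightarrow> ('a set \<Rightarrow> 'b) \<Rightarrow> bool"
  where
  "mono_embedding c V E X \<phi> \<mu> \<longleftrightarrow>
     inj_on \<phi> V \<and> inj_on \<mu> E \<and> \<phi> ` V \<inter> \<mu> ` E = {} \<and> \<phi> ` V \<union> \<mu> ` E \<subseteq> X \<and>
     (\<forall>e\<in>E. \<forall>u\<in>e. \<forall>v\<in>e. c (\<mu> e) (\<phi> u) = c (\<mu> e) (\<phi> v))"

inductive tree_on :: "'a set \<Rightarrow> 'a set set \<Rightarrow> bool" where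
  single: "tree_on {v} {}"
| leaf: "tree_on V E \<Longrightarrow> u \<in> V \<Longrightarrow> v \<notin> V \<Longrightarrow> tree_on (insert v V) (insert {u, v} E)"

lemma tree_on_finite: "tree_on V E \<Longrightarrow> finite V"
  by (induction rule: tree_on.induct) auto

lemma tree_on_edges_subset: "tree_on V E \<Longrightarrow> e \<in> E \<Longrightarrow> e \<subseteq> V"
  by (induction rule: tree_on.induct) auto

lemma tree_on_card_edges: "tree_on V E \<Longrightarrow> finite E \<and> card V = Suc (card E)"
proof (induction rule: tree_on.induct)
  case (leaf V E u v)
  then have "{u, v} \<notin> E" using tree_on_edges_subset by blast
  then show ?case using leaf tree_on_finite[OF leaf(1)] by simp
qed simp

lemma tree_on_card_pos: "tree_on V E \<Longrightarrow> 1 \<le> card V"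
  using tree_on_card_edges[of V E] by simp

lemma tree_on_remove_leaf:
  assumes "tree_on V E" and "2 \<le> card V"
  obtains V' E' u v where "tree_on V' E'" "u \<in> V'" "v \<notin> V'" "V = insert v V'" "E = insert {u, v} E'"
    "card V = Suc (card V')"
  using assms(1)
proof cases
  case (leaf V' E' u v)
  show ?thesis
    by (rule that[of V' E' u v]) (use leaf tree_on_finite[OF leaf(3)] in simp_all)
qed (use assms(2) in simp)

lemma mono_embedding_mono:
  "mono_embedding c V E X \<phi> \<mu> \<Longrightarrow> X \<subseteq> Y \<Longrightarrow> mono_embedding c V E Y \<phi> \<mu>"
  unfolding mono_embedding_def by (elim conjE, intro conjI) (assumption | erule (1) subset_trans)+

lemma mono_embedding_add_leaf:
  assumes emb: "mono_embedding c V E X \<phi> \<mu>" and E: "\<And>e. e \<in> E \<Longrightarrow> e \<subseteq> V"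
    and "u \<in> V" "v \<notin> V" and new: "s \<notin> X" "y \<notin> X" "s \<noteq> y" and mono: "c s (\<phi> u) = c s y"
  shows "mono_embedding c (insert v V) (insert {u, v} E) (insert s (insert y X))
           (\<phi>(v := y)) (\<mu>({u, v} := s))"
proof -
  have uv: "{u, v} \<notin> E" "u \<noteq> v" using E assms(3,4) by auto
  have e: "v \<notin> e" "e \<noteq> {u, v}" if "e \<in> E" for e using E[OF that] assms(4) by auto
  have img: "(\<phi>(v := y)) ` insert v V = insert y (\<phi> ` V)" 
    using assms(4) by (auto simp: image_iff)
  have img2: "(\<mu>({u, v} := s)) ` insert {u, v} E = insert s (\<mu> ` E)"
    using uv by (auto simp: image_iff)
  have X: "\<phi> ` V \<subseteq> X" "\<mu> ` E \<subseteq> X" using emb unfolding mono_embedding_def by auto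
  have inj1: "inj_on (\<phi>(v := y)) (insert v V)"
    using emb assms(4) X new unfolding mono_embedding_def inj_on_def by auto
  have inj2: "inj_on (\<mu>({u, v} := s)) (insert {u, v} E)"
    using emb uv X new unfolding mono_embedding_def inj_on_def by auto
  have edges_mono: "\<forall>e\<in>insert {u, v} E. \<forall>a\<in>e. \<forall>b\<in>e.
      c ((\<mu>({u, v} := s)) e) ((\<phi>(v := y)) a) = c ((\<mu>({u, v} := s)) e) ((\<phi>(v := y)) b)"
  proof (intro ballI)
    fix e a b assume h: "e \<in> insert {u, v} E" "a \<in> e" "b \<in> e"
    show "c ((\<mu>({u, v} := s)) e) ((\<phi>(v := y)) a) = c ((\<mu>({u, v} := s)) e) ((\<phi>(v := y)) b)"
    proof (cases "e = {u, v}")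
      case True
      then show ?thesis using h uv(2) mono by auto
    next
      case False
      then have "e \<in> E" using h by simp
      moreover then have "a \<noteq> v" "b \<noteq> v" using e h by auto
      moreover have "c (\<mu> e) (\<phi> a) = c (\<mu> e) (\<phi> b)"
        using \<open>e \<in> E\<close> h emb unfolding mono_embedding_def by blast
      ultimately show ?thesis using False by simp
    qed
  qed
  have disj: "insert y (\<phi> ` V) \<inter> insert s (\<mu> ` E) = {}"
  proof -
    have "\<phi> ` V \<inter> \<mu> ` E = {}" using emb unfolding mono_embedding_def by blast
    then show ?thesis using X new by blast
  qed
  have sub: "insert y (\<phi> ` V) \<union> insert s (\<mu> ` E) \<subseteq> insert s (insert y X)" using X by blast
  show ?thesis unfolding mono_embedding_def img img2 by (intro conjI inj1 inj2 disj sub edges_mono)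
qed

text \<open>
  Restoring a leaf takes one vertex \<open>y\<close> of \<open>A\<close> for the leaf and one vertex \<open>x\<close> of \<open>B\<close> for its middle
  vertex.  Since all tree vertices are placed in \<open>A\<close>, both edges at \<open>x\<close> have the colour of the join,
  and the placement of the leaf in \<open>A\<close> keeps this true.  The \<open>b\<close> leaves use up \<open>B\<close>
  and the \<open>b\<close> vertices that \<open>A\<close> has in excess of the subdivision of the smaller tree.
\<close>

lemma tree_embeds_in_join:
  assumes sym: "symp c" and "1 \<le> m"
    and small: "\<And>(V :: 'a set) E A. tree_on V E \<Longrightarrow> card V = m \<Longrightarrow> finite A \<Longrightarrow> card A = 2 * m - 1 \<Longrightarrow>
      \<exists>\<phi> \<mu>. mono_embedding c V E A \<phi> \<mu>"
    and "tree_on (V :: 'a set) E" "card V = m + b" "finite A" "finite B" "card B = b"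
    and "card A = 2 * m - 1 + b" "colour_join c k A B"
  shows "\<exists>\<phi> \<mu>. mono_embedding c V E (A \<union> B) \<phi> \<mu> \<and> \<phi> ` V \<subseteq> A"
  using assms(4-)
proof (induction b arbitrary: V E A B)
  case 0
  then obtain \<phi> \<mu> where "mono_embedding c V E A \<phi> \<mu>" using small by fastforce
  moreover then have "\<phi> ` V \<subseteq> A" by (simp add: mono_embedding_def)
  moreover have "B = {}" using 0 by simp
  ultimately show ?case by auto
next
  case (Suc b)
  have "2 \<le> card V" using Suc.prems(2) \<open>1 \<le> m\<close> by simp
  then obtain V' E' u v where T: "tree_on V' E'" "u \<in> V'" "v \<notin> V'" "V = insert v V'"
      "E = insert {u, v} E'" "card V = Suc (card V')"
    using tree_on_remove_leaf[OF Suc.prems(1)] by metis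
  from Suc.prems(5,6) obtain x y where xy: "x \<in> B" "y \<in> A"
    by (metis Zero_not_Suc add_Suc_right card.empty ex_in_conv)
  have "x \<notin> A" "y \<notin> B" and col: "\<And>a. a \<in> A \<Longrightarrow> c x a = k"
    using xy Suc.prems(7) symp_colour[OF sym] unfolding colour_join_def by blast+
  have join: "colour_join c k (A - {y}) (B - {x})"
    using Suc.prems(7) unfolding colour_join_def by blast
  obtain \<phi> \<mu> where emb: "mono_embedding c V' E' ((A - {y}) \<union> (B - {x})) \<phi> \<mu>" "\<phi> ` V' \<subseteq> A - {y}"
    using Suc.IH[OF T(1) _ _ _ _ _ join] Suc.prems T(6) xy by auto
  have "c x (\<phi> u) = c x y" using col emb(2) T(2) xy(2) by auto
  then have "mono_embedding c (insert v V') (insert {u, v} E')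
      (insert x (insert y ((A - {y}) \<union> (B - {x})))) (\<phi>(v := y)) (\<mu>({u, v} := x))"
    using mono_embedding_add_leaf[OF emb(1) tree_on_edges_subset[OF T(1)] T(2,3)]
      \<open>x \<notin> A\<close> \<open>y \<notin> B\<close> xy by auto
  moreover have "insert x (insert y ((A - {y}) \<union> (B - {x}))) = A \<union> B" using xy by auto
  moreover have "(\<phi>(v := y)) ` insert v V' \<subseteq> A" using emb(2) T(3) xy(2) by auto
  ultimately have "mono_embedding c V E (A \<union> B) (\<phi>(v := y)) (\<mu>({u, v} := x)) \<and> (\<phi>(v := y)) ` V \<subseteq> A"
    unfolding T(4,5) by (intro conjI) simp_all
  then show ?case by (intro exI)
qed

text \<open>
  The second leaf may hang on the first one; then the two leaves form a pendant path.
\<close>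

lemma two_leaves_embed_with_P4:
  assumes sym: "symp c" and P4: "colour_P4 c k p q r s"
    and T: "tree_on V'' E''" "u1 \<in> V''" "v1 \<notin> V''" "u2 \<in> insert v1 V''" "v2 \<notin> insert v1 V''"
    and emb: "mono_embedding c V'' E'' Y \<phi> \<mu>" and Y: "Y \<inter> {p, q, r, s} = {}"
  shows "\<exists>\<phi> \<mu>. mono_embedding c (insert v2 (insert v1 V'')) (insert {u2, v2} (insert {u1, v1} E''))
           (Y \<union> {p, q, r, s}) \<phi> \<mu>"
proof -
  obtain s1 y1 s2 y2 where new: "distinct [s1, y1, s2, y2]" "{s1, y1, s2, y2} \<subseteq> {p, q, r, s}"
      and col: "c s1 (\<phi> u1) = c s1 y1" "c s2 ((\<phi>(v1 := y1)) u2) = c s2 y2"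
  proof (cases "u2 = v1")
    case True
    then show ?thesis using P4_pending_path[OF sym P4, of "\<phi> u1"] that by auto
  next
    case False
    then show ?thesis using P4_two_pairs[OF sym P4, of "\<phi> u1" "\<phi> u2"] that by auto
  qed
  have out: "s1 \<notin> Y" "y1 \<notin> Y" "s2 \<notin> Y" "y2 \<notin> Y" using new(2) Y by auto
  have T1: "tree_on (insert v1 V'') (insert {u1, v1} E'')" using T by (simp add: tree_on.leaf)
  have "mono_embedding c (insert v1 V'') (insert {u1, v1} E'') (insert s1 (insert y1 Y))
      (\<phi>(v1 := y1)) (\<mu>({u1, v1} := s1))"
    using mono_embedding_add_leaf[OF emb tree_on_edges_subset[OF T(1)] T(2,3)] new(1) out col(1)
    by auto
  from mono_embedding_add_leaf[OF this tree_on_edges_subset[OF T1] T(4,5), of s2 y2]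
  have "mono_embedding c (insert v2 (insert v1 V'')) (insert {u2, v2} (insert {u1, v1} E''))
      (insert s2 (insert y2 (insert s1 (insert y1 Y))))
      (\<phi>(v1 := y1, v2 := y2)) (\<mu>({u1, v1} := s1, {u2, v2} := s2))"
    using new(1) out col(2) by auto
  moreover have "insert s2 (insert y2 (insert s1 (insert y1 Y))) \<subseteq> Y \<union> {p, q, r, s}"
    using new(2) by auto
  ultimately have "mono_embedding c (insert v2 (insert v1 V'')) (insert {u2, v2} (insert {u1, v1} E''))
      (Y \<union> {p, q, r, s}) (\<phi>(v1 := y1, v2 := y2)) (\<mu>({u1, v1} := s1, {u2, v2} := s2))"
    by (rule mono_embedding_mono)
  then show ?thesis by blast
qed

theorem subdivided_tree_embeds:
  fixes c :: "'b \<Rightarrow> 'b \<Rightarrow> bool" and V :: "'a set"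
  assumes sym: "symp c" and "tree_on V E" "finite X" "card X = 2 * card V - 1"
  shows "\<exists>\<phi> \<mu>. mono_embedding c V E X \<phi> \<mu>"
  using assms(2-)
proof (induction "card V" arbitrary: V E X rule: less_induct)
  case less
  show ?case
  proof (cases "2 \<le> card V")
    case False
    then have "card V = 1" "card E = 0" using tree_on_card_edges[OF less.prems(1)] by linarith+
    moreover have "finite E" using tree_on_card_edges[OF less.prems(1)] by simp
    ultimately obtain v where "V = {v}" "E = {}" by (auto simp: card_1_singleton_iff)
    moreover obtain x where "X = {x}"
      using less.prems(3) \<open>card V = 1\<close> by (auto simp: card_1_singleton_iff)
    ultimately have "mono_embedding c V E X (\<lambda>_. x) (\<lambda>_. x)" by (simp add: mono_embedding_def)
    then show ?thesis by blast
  next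
    case True
    then have "2 \<le> card X" using less.prems(3) by simp
    from less.prems(2) this sym show ?thesis
    proof (cases rule: join_or_P4_cases)
      case (join k A B)
      \<comment> \<open>\<open>|B| \<le> |A|\<close> and \<open>|A| + |B|\<close> is odd, so \<open>|B|\<close> leaves can be removed\<close>
      have fin: "finite A" "finite B" using less.prems(2) join(1) by auto
      have c: "card B < card V" "card V = (card V - card B) + card B"
          "card A = 2 * (card V - card B) - 1 + card B" "1 \<le> card V - card B"
        using less.prems(3) join by linarith+
      have "\<exists>\<phi> \<mu>. mono_embedding c V E (A \<union> B) \<phi> \<mu> \<and> \<phi> ` V \<subseteq> A"
      proof (rule tree_embeds_in_join[OF sym c(4) _ less.prems(1) c(2) fin refl c(3) join(2)])
        fix V' :: "'a set" and E' and A' :: "'b set"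
        assume "tree_on V' E'" "card V' = card V - card B" "finite A'" 
          "card A' = 2 * (card V - card B) - 1"
        then show "\<exists>\<phi> \<mu>. mono_embedding c V' E' A' \<phi> \<mu>" using less.hyps[of V' E' A'] c join(3) by simp
      qed
      then show ?thesis unfolding join(1) by blast
    next
      case (P4 k p q r s)
      have V: "3 \<le> card V" using less.prems(3) P4(3) by linarith
      obtain V1 E1 u2 v2 where T2: "tree_on V1 E1" "u2 \<in> V1" "v2 \<notin> V1" "V = insert v2 V1"
          "E = insert {u2, v2} E1" "card V = Suc (card V1)"
        using tree_on_remove_leaf[OF less.prems(1) \<open>2 \<le> card V\<close>] by metis
      moreover have "2 \<le> card V1" using T2 V by simp
      ultimately obtain V0 E0 u1 v1 where T1: "tree_on V0 E0" "u1 \<in> V0" "v1 \<notin> V0" "V1 = insert v1 V0"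
          "E1 = insert {u1, v1} E0" "card V1 = Suc (card V0)"
        using tree_on_remove_leaf[OF T2(1)] by metis
      have "card (X - {p, q, r, s}) = 2 * card V0 - 1"
        using P4(3) V less.prems(3) T1(6) T2(6) by linarith
      then obtain \<phi> \<mu> where emb: "mono_embedding c V0 E0 (X - {p, q, r, s}) \<phi> \<mu>"
        using less.hyps[of V0 E0 "X - {p, q, r, s}"] T1(1,6) T2(6) less.prems(2) by auto
      have "(X - {p, q, r, s}) \<union> {p, q, r, s} = X" using P4(1) by auto
      then show ?thesis
        using two_leaves_embed_with_P4[OF sym P4(2) T1(1,2,3) _ _ emb, of u2 v2] T2 T1 by auto
    qed
  qed
qed

section \<open>Spanning embeddings of subdivided cycles\<close>

text \<open>
  The cyclic sequence \<open>f 0, g 0, f 1, g 1, \<dots>\<close>, where the two edges at each \<open>g i\<close> have the same colour.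
\<close>

definition alternating_cycle ::
    "('b \<Rightarrow> 'b \<Rightarrow> bool) \<Rightarrow> nat \<Rightarrow> 'b set \<Rightarrow> (nat \<Rightarrow> 'b) \<Rightarrow> (nat \<Rightarrow> 'b) \<Rightarrow> bool" where
  "alternating_cycle c n X f g \<longleftrightarrow>
     inj_on f {..<n} \<and> inj_on g {..<n} \<and> f ` {..<n} \<inter> g ` {..<n} = {} \<and>
     f ` {..<n} \<union> g ` {..<n} \<subseteq> X \<and> (\<forall>i<n. c (g i) (f i) = c (g i) (f (Suc i mod n)))"

lemma tree_on_path: "tree_on {..k} ((\<lambda>i. {i, Suc i}) ` {..<k})"
proof (induction k)
  case 0
  then show ?case using tree_on.single[of "0 :: nat"] by simp
next
  case (Suc k)
  then have "tree_on (insert (Suc k) {..k}) (insert {k, Suc k} ((\<lambda>i. {i, Suc i}) ` {..<k}))"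
    by (rule tree_on.leaf) simp_all
  then show ?case by (simp add: atMost_Suc lessThan_Suc)
qed

lemma subdivided_path_embeds:
  assumes sym: "symp c" and "finite X" "card X = 2 * k + 1"
  shows "\<exists>f g. inj_on f {..k} \<and> inj_on g {..<k} \<and> f ` {..k} \<inter> g ` {..<k} = {} \<and>
           f ` {..k} \<union> g ` {..<k} \<subseteq> X \<and> (\<forall>i<k. c (g i) (f i) = c (g i) (f (Suc i)))"
proof -
  let ?e = "\<lambda>i :: nat. {i, Suc i}"
  obtain f \<mu> where emb: "mono_embedding c {..k} (?e ` {..<k}) X f \<mu>"
    using subdivided_tree_embeds[OF sym tree_on_path assms(2), of k] assms(3) by auto
  have "inj_on ?e {..<k}" by (auto simp: inj_on_def doubleton_eq_iff)
  then have "inj_on (\<mu> \<circ> ?e) {..<k}" using emb by (simp add: mono_embedding_def comp_inj_on)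
  moreover have "\<forall>i<k. c (\<mu> (?e i)) (f i) = c (\<mu> (?e i)) (f (Suc i))"
  proof (intro allI impI)
    fix i assume "i < k"
    then have "?e i \<in> ?e ` {..<k}" by blast
    then show "c (\<mu> (?e i)) (f i) = c (\<mu> (?e i)) (f (Suc i))"
      using emb unfolding mono_embedding_def by (meson insertI1 insertI2)
  qed
  moreover have "(\<mu> \<circ> ?e) ` {..<k} = \<mu> ` ?e ` {..<k}" by (rule image_comp[symmetric])
  ultimately have "inj_on f {..k} \<and> inj_on (\<mu> \<circ> ?e) {..<k} \<and> f ` {..k} \<inter> (\<mu> \<circ> ?e) ` {..<k} = {} \<and>
      f ` {..k} \<union> (\<mu> \<circ> ?e) ` {..<k} \<subseteq> X \<and>
      (\<forall>i<k. c ((\<mu> \<circ> ?e) i) (f i) = c ((\<mu> \<circ> ?e) i) (f (Suc i)))"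
    using emb unfolding mono_embedding_def by (simp only: comp_apply simp_thms)
  then show ?thesis by (intro exI)
qed

text \<open>
  Here \<open>|A| = 2m + |B|\<close> with \<open>m = n - |B|\<close>.  A subset of \<open>A\<close> with \<open>2m + 1\<close> vertices is spanned by a
  subdivided path.  There remain \<open>|B| - 1\<close> vertices of \<open>A\<close>, and they and the vertices of \<open>B\<close>
  alternate on the way back from the end of the path to its start.
\<close>

lemma alternating_cycle_in_join:
  assumes sym: "symp c" and fin: "finite A" "finite B" and join: "colour_join c k A B"
    and B: "1 \<le> card B" "card B \<le> card A" and n: "card A + card B = 2 * n"
  shows "\<exists>f g. alternating_cycle c n (A \<union> B) f g"
proof -
  define m where "m = n - card B"
  have bn: "n = m + card B" and A: "card A = 2 * m + 1 + (card B - 1)"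
    using B n unfolding m_def by linarith+
  obtain A0 where A0: "A0 \<subseteq> A" "card A0 = 2 * m + 1"
    using obtain_subset_with_card_n[of "2 * m + 1" A] A by auto
  then have finA0: "finite A0" using fin finite_subset by blast
  obtain f0 g0 where path: "inj_on f0 {..m}" "inj_on g0 {..<m}" "f0 ` {..m} \<inter> g0 ` {..<m} = {}"
      "f0 ` {..m} \<union> g0 ` {..<m} \<subseteq> A0" "\<forall>i<m. c (g0 i) (f0 i) = c (g0 i) (f0 (Suc i))"
    using subdivided_path_embeds[OF sym finA0 A0(2)] by metis
  have "card (A - A0) = card B - 1" using A A0 finA0 by (simp add: card_Diff_subset)
  then obtain h where h: "bij_betw h {..<card B - 1} (A - A0)"
    using fin by (metis ex_bij_betw_nat_finite finite_Diff lessThan_atLeast0)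
  obtain h' where h': "bij_betw h' {..<card B} B"
    using fin by (metis ex_bij_betw_nat_finite lessThan_atLeast0)
  define f where "f = (\<lambda>i. if i \<le> m then f0 i else h (i - Suc m))"
  define g where "g = (\<lambda>i. if i < m then g0 i else h' (i - m))"
  have hA: "h i \<in> A - A0" if "i < card B - 1" for i using h that by (auto simp: bij_betw_def)
  have hB: "h' i \<in> B" if "i < card B" for i using h' that by (auto simp: bij_betw_def)
  have f0A: "f0 i \<in> A0" if "i \<le> m" for i using path(4) that by auto
  have g0A: "g0 i \<in> A0" if "i < m" for i using path(4) that by auto
  have idx: "j - Suc m < card B - 1" if "m < j" "j < n" for j using that bn by linarith
  have AB: "A \<inter> B = {}" using join by (simp add: colour_join_def)
  have fA: "f i \<in> A" if "i < n" for i
    using f0A[of i] hA[OF idx[of i]] A0(1) that unfolding f_def by auto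
  have gB: "g i \<in> B" if "m \<le> i" "i < n" for i
    using hB[of "i - m"] that bn unfolding g_def by auto
  have "inj_on f {..<n}"
  proof (rule inj_onI)
    fix i j assume ij: "i \<in> {..<n}" "j \<in> {..<n}" "f i = f j"
    consider "i \<le> m" "j \<le> m" | "i \<le> m" "m < j" | "m < i" "j \<le> m" | "m < i" "m < j" by linarith
    then show "i = j"
    proof cases
      case 1
      then show ?thesis using ij path(1) by (auto simp: f_def inj_on_def)
    next
      case 2
      then show ?thesis using ij f0A[of i] hA[OF idx[of j]] by (auto simp: f_def)
    next
      case 3
      then show ?thesis using ij f0A[of j] hA[OF idx[of i]] by (auto simp: f_def)
    next
      case 4
      then have "h (i - Suc m) = h (j - Suc m)" using ij by (simp add: f_def)
      moreover have "i - Suc m \<in> {..<card B - 1}" "j - Suc m \<in> {..<card B - 1}"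
        using ij 4 bn by auto
      ultimately have "i - Suc m = j - Suc m" using h unfolding bij_betw_def inj_on_def by blast
      then show ?thesis using 4 by linarith
    qed
  qed
  moreover have "inj_on g {..<n}"
  proof (rule inj_onI)
    fix i j assume ij: "i \<in> {..<n}" "j \<in> {..<n}" "g i = g j"
    consider "i < m" "j < m" | "i < m" "m \<le> j" | "m \<le> i" "j < m" | "m \<le> i" "m \<le> j" by linarith
    then show "i = j"
    proof cases
      case 1
      then show ?thesis using ij path(2) by (auto simp: g_def inj_on_def)
    next
      case 2
      then have "g i \<in> A" using g0A[of i] A0(1) by (auto simp: g_def)
      then show ?thesis using gB[of j] 2 ij AB by auto
    next
      case 3
      then have "g j \<in> A" using g0A[of j] A0(1) by (auto simp: g_def)
      then show ?thesis using gB[of i] 3 ij AB by auto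
    next
      case 4
      then have "h' (i - m) = h' (j - m)" using ij by (simp add: g_def)
      moreover have "i - m \<in> {..<card B}" "j - m \<in> {..<card B}" using ij 4 bn by auto
      ultimately have "i - m = j - m" using h' unfolding bij_betw_def inj_on_def by blast
      then show ?thesis using 4 by linarith
    qed
  qed
  moreover have "f i \<noteq> g j" if "i < n" "j < n" for i j
  proof (cases "j < m")
    case True
    then have g: "g j = g0 j" "g j \<in> A0" using g0A[of j] by (auto simp: g_def)
    show ?thesis
    proof (cases "i \<le> m")
      case True
      then show ?thesis using path(3) \<open>j < m\<close> by (auto simp: f_def g_def)
    next
      case False
      then have "f i \<notin> A0" using hA[OF idx[of i]] that by (auto simp: f_def)
      then show ?thesis using g by auto
    qed
  next
    case False
    then show ?thesis using fA[of i] gB[of j] that AB by auto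
  qed
  then have "f ` {..<n} \<inter> g ` {..<n} = {}" by auto
  moreover have "f ` {..<n} \<union> g ` {..<n} \<subseteq> A \<union> B"
  proof -
    have "g i \<in> A \<union> B" if "i < n" for i
      using gB[of i] that g0A[of i] A0(1) by (cases "i < m") (auto simp: g_def)
    then show ?thesis using fA by auto
  qed
  moreover have "\<forall>i<n. c (g i) (f i) = c (g i) (f (Suc i mod n))"
  proof (intro allI impI)
    fix i assume i: "i < n"
    show "c (g i) (f i) = c (g i) (f (Suc i mod n))"
    proof (cases "i < m")
      case True
      then have "Suc i mod n = Suc i" using bn B by simp
      then show ?thesis using True path(5) by (simp add: f_def g_def)
    next
      case False
      have "Suc i mod n < n" using i by simp
      then show ?thesis
        using fA[OF i] fA[of "Suc i mod n"] gB[of i] False i colour_join_swap[OF sym join]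
        unfolding colour_join_def by simp
    qed
  qed
  ultimately have "alternating_cycle c n (A \<union> B) f g" unfolding alternating_cycle_def by (intro conjI)
  then show ?thesis by (intro exI)
qed

lemma alternating_cycle_with_P4:
  assumes sym: "symp c" and P4: "colour_P4 c k p q r s" and Y: "finite Y" "Y \<inter> {p, q, r, s} = {}"
    and n: "3 \<le> n" "card Y + 4 = 2 * n"
  shows "\<exists>f g. alternating_cycle c n (Y \<union> {p, q, r, s}) f g"
proof -
  define m where "m = n - 3"
  have m: "n = m + 3" "card Y = 2 * m + 2" using n unfolding m_def by linarith+
  \<comment> \<open>an exceptional vertex is taken for \<open>e\<close> only if there are no others\<close>
  obtain e where e: "e \<in> Y"
    "exceptional c k p q r s e \<longrightarrow> (\<forall>w\<in>Y. exceptional c k p q r s w)"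
  proof (cases "\<forall>w\<in>Y. exceptional c k p q r s w")
    case True
    moreover have "Y \<noteq> {}" using m by auto
    ultimately show ?thesis using that by blast
  next
    case False
    then show ?thesis using that by blast
  qed
  have "card (Y - {e}) = 2 * m + 1" using e m Y by simp
  then obtain f0 g0 where path: "inj_on f0 {..m}" "inj_on g0 {..<m}" "f0 ` {..m} \<inter> g0 ` {..<m} = {}"
      "f0 ` {..m} \<union> g0 ` {..<m} \<subseteq> Y - {e}" "\<forall>i<m. c (g0 i) (f0 i) = c (g0 i) (f0 (Suc i))"
    using subdivided_path_embeds[OF sym, of "Y - {e}" m] Y by auto
  have f0: "f0 m \<in> Y" "f0 0 \<in> Y" using path(4) by auto
  have "e \<notin> {p, q, r, s}" using e Y by auto
  moreover have "exceptional c k p q r s e \<longrightarrow>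
      exceptional c k p q r s (f0 m) \<and> exceptional c k p q r s (f0 0)"
    using e(2) f0 by blast
  ultimately have "\<exists>x1 y1 x2 y2 x3. distinct [x1, y1, x2, y2, x3] \<and>
      {x1, y1, x2, y2, x3} \<subseteq> {p, q, r, s, e} \<and>
      c x1 (f0 m) = c x1 y1 \<and> c x2 y1 = c x2 y2 \<and> c x3 y2 = c x3 (f0 0)"
    by (rule P4_closes_path[OF sym P4])
  then obtain x1 y1 x2 y2 x3 where new: "distinct [x1, y1, x2, y2, x3]"
      "{x1, y1, x2, y2, x3} \<subseteq> {p, q, r, s, e}"
      and col: "c x1 (f0 m) = c x1 y1" "c x2 y1 = c x2 y2" "c x3 y2 = c x3 (f0 0)"
    by (elim exE conjE) (rule that)
  have out: "x \<notin> Y - {e}" if "x \<in> {x1, y1, x2, y2, x3}" for x using that new(2) Y by auto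
  have f0Y: "f0 i \<in> Y - {e}" if "i \<le> m" for i using path(4) that by auto
  have g0Y: "g0 i \<in> Y - {e}" if "i < m" for i using path(4) that by auto
  define f where "f = f0(m + 1 := y1, m + 2 := y2)"
  define g where "g = g0(m := x1, m + 1 := x2, m + 2 := x3)"
  have f: "f (m + 1) = y1" "f (m + 2) = y2" "\<And>i. i \<le> m \<Longrightarrow> f i = f0 i" by (auto simp: f_def)
  have g: "g m = x1" "g (m + 1) = x2" "g (m + 2) = x3" "\<And>i. i < m \<Longrightarrow> g i = g0 i"
    by (auto simp: g_def)
  have dom: "{..<n} = insert (m + 1) (insert (m + 2) {..m})"
    "{..<n} = insert m (insert (m + 1) (insert (m + 2) {..<m}))" unfolding m(1) by auto
  have f_old: "f ` {..m} = f0 ` {..m}" by (rule image_cong) (simp_all add: f(3))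
  have g_old: "g ` {..<m} = g0 ` {..<m}" by (rule image_cong) (simp_all add: g(4))
  have fim: "f ` {..<n} = insert y1 (insert y2 (f0 ` {..m}))"
    unfolding dom(1) image_insert f f_old by simp
  have gim: "g ` {..<n} = insert x1 (insert x2 (insert x3 (g0 ` {..<m})))"
    unfolding dom(2) image_insert g g_old by simp
  have fresh: "y \<notin> f0 ` {..m}" "y \<notin> g0 ` {..<m}" if "y \<in> {x1, y1, x2, y2, x3}" for y
    using path(4) out[OF that] by auto
  have "inj_on f {..<n}"
  proof -
    have "{..m} - {m + 2} = {..m}" "insert (m + 2) {..m} - {m + 1} = insert (m + 2) {..m}" by auto
    moreover have "inj_on f {..m}" using path(1) f(3) inj_on_cong[of "{..m}" f f0] by simp
    ultimately show ?thesis
      unfolding dom(1) inj_on_insert using new(1) fresh[of y1] fresh[of y2] by (simp add: f_old f(1,2)[simplified])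
  qed
  moreover have "inj_on g {..<n}"
  proof -
    have "{..<m} - {m + 2} = {..<m}" "insert (m + 2) {..<m} - {m + 1} = insert (m + 2) {..<m}"
      "insert (m + 1) (insert (m + 2) {..<m}) - {m} = insert (m + 1) (insert (m + 2) {..<m})" by auto
    moreover have "inj_on g {..<m}" using path(2) g(4) inj_on_cong[of "{..<m}" g g0] by simp
    ultimately show ?thesis
      unfolding dom(2) inj_on_insert using new(1) fresh[of x1] fresh[of x2] fresh[of x3]
      by (simp add: g_old g(1-3)[simplified])
  qed
  moreover have "f ` {..<n} \<inter> g ` {..<n} = {}"
    unfolding fim gim using path(3) new(1) fresh by auto
  moreover have "f ` {..<n} \<union> g ` {..<n} \<subseteq> Y \<union> {p, q, r, s}"
  proof -
    have "{x1, y1, x2, y2, x3} \<subseteq> Y \<union> {p, q, r, s}"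
      by (rule subset_trans[OF new(2)]) (use e(1) in simp)
    moreover have "f0 ` {..m} \<union> g0 ` {..<m} \<subseteq> Y \<union> {p, q, r, s}"
      by (rule subset_trans[OF path(4)]) blast
    ultimately show ?thesis unfolding fim gim by simp
  qed
  moreover have "\<forall>i<n. c (g i) (f i) = c (g i) (f (Suc i mod n))"
  proof (intro allI impI)
    fix i assume "i < n"
    then consider "i < m" | "i = m" | "i = m + 1" | "i = m + 2" unfolding m(1) by linarith
    then show "c (g i) (f i) = c (g i) (f (Suc i mod n))"
    proof cases
      case 1
      then show ?thesis using path(5) f g m(1) by simp
    next
      case 2
      then show ?thesis using col(1) f g m(1) by simp
    next
      case 3
      then show ?thesis using col(2) f g m(1) by simp
    next
      case 4
      then have "Suc i mod n = 0" using m(1) by (simp add: numeral_3_eq_3)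
      then show ?thesis using col(3) f g 4 by simp
    qed
  qed
  ultimately have "alternating_cycle c n (Y \<union> {p, q, r, s}) f g" unfolding alternating_cycle_def by (intro conjI)
  then show ?thesis by (intro exI)
qed

theorem subdivided_cycle_embeds:
  assumes sym: "symp c" and X: "finite X" "card X = 2 * n" and n: "3 \<le> n"
  shows "\<exists>f g. alternating_cycle c n X f g"
proof -
  have "2 \<le> card X" using X n by simp
  from X(1) this sym show ?thesis
  proof (cases rule: join_or_P4_cases)
    case (join k A B)
    then have "finite A" "finite B" using X(1) by auto
    from alternating_cycle_in_join[OF sym this join(2-4)] show ?thesis using join(1,5) X(2) by simp
  next
    case (P4 k p q r s)
    have "(X - {p, q, r, s}) \<union> {p, q, r, s} = X" using P4(1) by auto
    then show ?thesis
      using alternating_cycle_with_P4[OF sym P4(2), of "X - {p, q, r, s}" n] X n P4(3) by auto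
  qed
qed

section \<open>Acyclic connected graphs are built by adding leaves\<close>

lemma path_edges_singleton [simp]: "path_edges [x] = {}"
  by (simp add: path_edges_def)

lemma path_edges_Cons: "p \<noteq> [] \<Longrightarrow> path_edges (x # p) = insert {x, hd p} (path_edges p)"
proof -
  assume "p \<noteq> []"
  have "{..<length p} = insert 0 (Suc ` {..<length p - 1})"
    using \<open>p \<noteq> []\<close> lessThan_Suc_eq_insert_0[of "length p - 1"] by simp
  moreover have "path_edges q = (\<lambda>i. {q ! i, q ! Suc i}) ` {..<length q - 1}" for q :: "'a list"
    unfolding path_edges_def by auto
  ultimately show ?thesis
    using \<open>p \<noteq> []\<close> by (simp add: image_image hd_conv_nth)
qed

lemma path_edges_snoc: "p \<noteq> [] \<Longrightarrow> path_edges (p @ [x]) = insert {last p, x} (path_edges p)"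
proof (induction p)
  case (Cons a p)
  then show ?case by (cases "p = []") (auto simp: path_edges_Cons)
qed simp

lemma path_edges_subset: "e \<in> path_edges p \<Longrightarrow> e \<subseteq> set p"
  unfolding path_edges_def by auto

lemma tree_on_path_between:
  assumes "tree_on V E" "a \<in> V" "b \<in> V"
  shows "\<exists>p. p \<noteq> [] \<and> distinct p \<and> set p \<subseteq> V \<and> path_edges p \<subseteq> E \<and> hd p = a \<and> last p = b"
  using assms
proof (induction arbitrary: a b rule: tree_on.induct)
  case (single v)
  then show ?case by (intro exI[of _ "[v]"]) simp
next
  case (leaf V E u v)
  consider "a \<in> V" "b \<in> V" | "a = v" "b = v" | "a = v" "b \<in> V" | "a \<in> V" "b = v"
    using leaf.prems by auto
  then show ?case
  proof cases
    case 1
    then obtain p where "p \<noteq> []" "distinct p" "set p \<subseteq> V" "path_edges p \<subseteq> E" "hd p = a" "last p = b"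
      using leaf.IH by metis
    then show ?thesis by (intro exI[of _ p]) auto
  next
    case 2
    then show ?thesis by (intro exI[of _ "[v]"]) simp
  next
    case 3
    then obtain p where "p \<noteq> []" "distinct p" "set p \<subseteq> V" "path_edges p \<subseteq> E" "hd p = u" "last p = b"
      using leaf.IH leaf.hyps(2) by metis
    then show ?thesis using 3 leaf.hyps(3)
      by (intro exI[of _ "v # p"]) (auto simp: path_edges_Cons insert_commute)
  next
    case 4
    then obtain p where "p \<noteq> []" "distinct p" "set p \<subseteq> V" "path_edges p \<subseteq> E" "hd p = a" "last p = u"
      using leaf.IH leaf.hyps(2) by metis
    then show ?thesis using 4 leaf.hyps(3)
      by (intro exI[of _ "p @ [v]"]) (auto simp: path_edges_snoc)
  qed
qed

lemma path_leaves_set: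
  "p \<noteq> [] \<Longrightarrow> hd p \<in> W \<Longrightarrow> last p \<notin> W \<Longrightarrow> \<exists>x\<in>W. \<exists>y. y \<notin> W \<and> {x, y} \<in> path_edges p"
proof (induction p)
  case (Cons a p)
  then have "p \<noteq> []" by auto
  then show ?case using Cons by (cases "hd p \<in> W") (auto simp: path_edges_Cons)
qed simp

text \<open>
  A subtree with as many vertices as possible contains all vertices, since by connectivity
  some edge would leave it otherwise.  A further edge would close the path between its ends in the
  subtree to a cycle.
\<close>

lemma is_tree_imp_tree_on:
  assumes "is_tree T"
  shows "tree_on (verts T) (edges T)"
proof -
  have simple: "simple_graph T" and conn: "connected_graph T"
    and acyclic: "\<And>C. is_subgraph C T \<Longrightarrow> \<not> is_cycle C"
    using assms by (auto simp: is_tree_def)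
  define S where "S = {W. W \<subseteq> verts T \<and> (\<exists>F \<subseteq> edges T. tree_on W F)}"
  obtain r where "r \<in> verts T" using conn by (auto simp: connected_graph_def)
  then have "{r} \<in> S" using tree_on.single[of r] unfolding S_def by (intro CollectI conjI exI[of _ "{}"]) auto
  then have "S \<noteq> {}" by blast
  have "finite S" using simple by (simp add: simple_graph_def S_def)
  from finite_has_maximal[OF this \<open>S \<noteq> {}\<close>] obtain W
    where W: "W \<in> S" and "\<forall>W'\<in>S. W \<subseteq> W' \<longrightarrow> W = W'" by (elim bexE) (rule that)
  then have max: "W = W'" if "W' \<in> S" "W \<subseteq> W'" for W' using that by blast
  obtain F where WF: "W \<subseteq> verts T" "F \<subseteq> edges T" "tree_on W F" using W by (auto simp: S_def)
  have W_eq: "W = verts T"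
  proof (rule ccontr)
    assume "W \<noteq> verts T"
    then obtain v where v: "v \<in> verts T" "v \<notin> W" using WF(1) by auto
    obtain w where w: "w \<in> W" using tree_on_card_pos[OF WF(3)] by fastforce
    then obtain p where p: "is_path T p" "hd p = w" "last p = v"
      using conn v(1) WF(1) unfolding connected_graph_def by blast
    then obtain x y where xy: "x \<in> W" "y \<notin> W" "{x, y} \<in> path_edges p"
      using path_leaves_set[of p W] w v by (auto simp: is_path_def)
    then have "{x, y} \<in> edges T" "y \<in> verts T"
      using p(1) path_edges_subset[OF xy(3)] by (auto simp: is_path_def)
    then have "insert {x, y} F \<subseteq> edges T" "insert y W \<subseteq> verts T" using WF(1,2) by auto
    then have "insert y W \<in> S" using tree_on.leaf[OF WF(3) xy(1,2)] unfolding S_def by blast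
    then show False using max[of "insert y W"] xy(2) by blast
  qed
  have "edges T \<subseteq> F"
  proof
    fix e assume e: "e \<in> edges T"
    show "e \<in> F"
    proof (rule ccontr)
      assume "e \<notin> F"
      obtain a b where ab: "e = {a, b}" "a \<noteq> b" "a \<in> W" "b \<in> W"
        using simple e W_eq unfolding simple_graph_def by (metis card_2_iff insert_subset)
      obtain p where p: "p \<noteq> []" "distinct p" "set p \<subseteq> W" "path_edges p \<subseteq> F" "hd p = a" "last p = b"
        using tree_on_path_between[OF WF(3) ab(3,4)] by metis
      have "3 \<le> length p"
      proof (rule ccontr)
        assume "\<not> 3 \<le> length p"
        then have "length p < 3" by simp
        moreover obtain t where "p = a # t" using p(1,5) by (cases p) auto
        ultimately have "p = [a] \<or> p = [a, b]" using p(6) by (cases t) auto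
        then consider "p = [a]" | "p = [a, b]" by blast
        then show False
          using p(4,6) ab \<open>e \<notin> F\<close> by cases (auto simp: path_edges_Cons)
      qed
      let ?C = "\<lparr>verts = set p, edges = insert {last p, hd p} (path_edges p)\<rparr>"
      have "is_cycle ?C" using p(2) \<open>3 \<le> length p\<close> by (auto simp: is_cycle_def)
      have sub: "edges ?C \<subseteq> edges T" using p(4,5,6) WF(2) e ab(1) by (auto simp: insert_commute)
      have "f \<subseteq> set p" if "f \<in> edges ?C" for f
        using that path_edges_subset[of f p] p(1) by auto
      then have "simple_graph ?C" using sub simple unfolding simple_graph_def by auto
      then have "is_subgraph ?C T" using sub simple p(3) WF(1) unfolding is_subgraph_def by auto
      then show False using acyclic \<open>is_cycle ?C\<close> by blast
    qed
  qed
  then show ?thesis using W_eq WF by auto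
qed

section \<open>Weightings in \<open>\<int>\<^sub>2\<close> as colourings\<close>

lemma inner_verts_3 [simp]: "inner_verts [x, y, z] = {y}"
  by (simp add: inner_verts_def)

lemma path_edges_3 [simp]: "path_edges [x, y, z] = {{x, y}, {y, z}}"
  by (simp add: path_edges_Cons)

lemma path_weight_eq_0:
  assumes "edge_weighting 2 G \<omega>" "{x, y} \<in> edges G" "{y, z} \<in> edges G" "x \<noteq> z"
    and same: "(\<omega> {y, x} = 0) = (\<omega> {y, z} = 0)"
  shows "path_weight 2 \<omega> [x, y, z] = \<one>\<^bsub>integer_mod_group 2\<^esub>"
proof -
  interpret comm_group "integer_mod_group 2" by simp
  have \<omega>: "\<omega> {x, y} \<in> carrier (integer_mod_group 2)" "\<omega> {y, z} \<in> carrier (integer_mod_group 2)"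
    using assms(1-3) by (auto simp: edge_weighting_def)
  have ne: "{x, y} \<noteq> {y, z}" using assms(4) by (auto simp: doubleton_eq_iff)
  have "finprod (integer_mod_group 2) \<omega> {{x, y}, {y, z}} = (\<omega> {x, y} + \<omega> {y, z}) mod 2"
    using \<omega> ne by (simp add: mod_simps)
  moreover have "\<omega> {x, y} \<in> {0, 1}" "\<omega> {y, z} \<in> {0, 1}"
    using \<omega> by (auto simp: carrier_integer_mod_group)
  then have "(\<omega> {x, y} + \<omega> {y, z}) mod 2 = 0"
    using same by (auto simp: insert_commute)
  ultimately show ?thesis by (simp add: path_weight_def)
qed

lemma divisible_subdivision_from_embedding:
  assumes H: "simple_graph H" and \<omega>: "edge_weighting 2 (complete_graph f) \<omega>"
    and emb: "mono_embedding (\<lambda>x y. \<omega> {x, y} = 0) (verts H) (edges H) {..<f} \<phi> \<mu>"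
  shows "has_divisible_subdivision 2 1 H (complete_graph f) \<omega>"
proof -
  have "\<exists>a b. e = {a, b} \<and> a \<noteq> b" if "e \<in> edges H" for e
    using H that unfolding simple_graph_def by (metis card_2_iff)
  then obtain a b where ab: "\<And>e. e \<in> edges H \<Longrightarrow> e = {a e, b e} \<and> a e \<noteq> b e" by metis
  define P where "P = (\<lambda>e. [\<phi> (a e), \<mu> e, \<phi> (b e)])"
  define S where "S = \<lparr>verts = \<phi> ` verts H \<union> (\<Union>e\<in>edges H. set (P e)),
    edges = (\<Union>e\<in>edges H. path_edges (P e))\<rparr>"
  have abV: "a e \<in> verts H" "b e \<in> verts H" if "e \<in> edges H" for e
    using H ab[OF that] that unfolding simple_graph_def by blast+
  have inj: "inj_on \<phi> (verts H)" "inj_on \<mu> (edges H)" and disj: "\<phi> ` verts H \<inter> \<mu> ` edges H = {}"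
    and range: "\<phi> ` verts H \<union> \<mu> ` edges H \<subseteq> {..<f}"
    and same_colour: "\<forall>e\<in>edges H. \<forall>u\<in>e. \<forall>v\<in>e. (\<omega> {\<mu> e, \<phi> u} = 0) = (\<omega> {\<mu> e, \<phi> v} = 0)"
    using emb unfolding mono_embedding_def by - (elim conjE, assumption)+
  have ne: "\<phi> (a e) \<noteq> \<phi> (b e)" "\<phi> (a e) \<noteq> \<mu> e" "\<phi> (b e) \<noteq> \<mu> e" if "e \<in> edges H" for e
    using ab[OF that] abV[OF that] inj(1) disj that by (auto simp: inj_on_def)
  have lt: "\<phi> (a e) < f" "\<phi> (b e) < f" "\<mu> e < f" if "e \<in> edges H" for e
    using range abV[OF that] that by auto
  have edge: "{\<phi> (a e), \<mu> e} \<in> edges (complete_graph f)" "{\<mu> e, \<phi> (b e)} \<in> edges (complete_graph f)"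
    if "e \<in> edges H" for e
    using ne[OF that] lt[OF that] by (auto simp: complete_graph_def card_2_iff)
  have complete: "simple_graph (complete_graph f)" 
    by (auto simp: simple_graph_def complete_graph_def)
  have vS: "verts S \<subseteq> verts (complete_graph f)"
    using range lt by (auto simp: S_def P_def complete_graph_def)
  have eS: "edges S \<subseteq> edges (complete_graph f)"
    using edge by (auto simp: S_def P_def)
  have "g \<subseteq> verts S" if "g \<in> edges S" for g
    using that by (auto simp: S_def P_def)
  then have "simple_graph S"
    using complete vS eS unfolding simple_graph_def by (meson finite_subset subset_iff)
  then have sub: "is_subgraph S (complete_graph f)"
    using complete vS eS by (simp add: is_subgraph_def)
  have paths: "is_path S (P e) \<and> length (P e) = Suc (1 + 1) \<and>
        {hd (P e), last (P e)} = \<phi> ` e \<and> inner_verts (P e) \<inter> \<phi> ` verts H = {}"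
    if "e \<in> edges H" for e
  proof (intro conjI)
    show "is_path S (P e)"
      using that ne[OF that] by (auto simp: is_path_def S_def P_def)
    show "{hd (P e), last (P e)} = \<phi> ` e"
    proof -
      have "e = {a e, b e}" using ab[OF that] by (rule conjunct1)
      then have "\<phi> ` e = {\<phi> (a e), \<phi> (b e)}" by (metis image_empty image_insert)
      then show ?thesis by (simp add: P_def)
    qed
    show "inner_verts (P e) \<inter> \<phi> ` verts H = {}"
      using disj that by (auto simp: P_def)
  qed (simp add: P_def)
  have "inner_verts (P e) \<inter> inner_verts (P e') = {}"
    if "e \<in> edges H" "e' \<in> edges H" "e \<noteq> e'" for e e'
    using inj(2) that by (auto simp: P_def inj_on_def)
  then have "subdivision_via 1 H S \<phi> P"
    unfolding subdivision_via_def using inj(1) paths by (simp add: S_def)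
  moreover have "path_weight 2 \<omega> (P e) = \<one>\<^bsub>integer_mod_group 2\<^esub>" if "e \<in> edges H" for e
    unfolding P_def
  proof (rule path_weight_eq_0[OF \<omega> edge[OF that] ne(1)[OF that]])
    have "a e \<in> e" "b e \<in> e" using ab[OF that] by blast+
    then show "(\<omega> {\<mu> e, \<phi> (a e)} = 0) = (\<omega> {\<mu> e, \<phi> (b e)} = 0)"
      by (rule same_colour[rule_format, OF that])
  qed
  ultimately show ?thesis using sub unfolding has_divisible_subdivision_def by blast
qed

text \<open>
  The inner vertices of the subdivision paths differ from each other and from the images of the
  vertices of \<open>H\<close>, so the subdivision itself has \<open>|V| + |E|\<close> vertices.
\<close>

lemma card_le_of_divisible_subdivision:
  assumes H: "simple_graph H" and sub: "has_divisible_subdivision q 1 H (complete_graph f) \<omega>"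
  shows "card (verts H) + card (edges H) \<le> f"
proof -
  obtain S \<phi> P where S: "is_subgraph S (complete_graph f)" and via: "subdivision_via 1 H S \<phi> P"
    using sub unfolding has_divisible_subdivision_def by blast
  have finV: "finite (verts H)" using H by (simp add: simple_graph_def)
  then have finE: "finite (edges H)"
    using H finite_subset[of "edges H" "Pow (verts H)"] by (auto simp: simple_graph_def)
  have inj: "inj_on \<phi> (verts H)" using via by (simp add: subdivision_via_def)
  define m where "m = (\<lambda>e. P e ! 1)"
  have inner: "inner_verts (P e) = {m e}" "m e \<in> set (P e)" if "e \<in> edges H" for e
  proof -
    have "length (P e) = 3" using via that by (simp add: subdivision_via_def)
    then obtain x y z where "P e = [x, y, z]" by (auto simp: numeral_3_eq_3 length_Suc_conv)
    then show "inner_verts (P e) = {m e}" "m e \<in> set (P e)" by (simp_all add: m_def)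
  qed
  have disj: "m e \<noteq> m e'" if "e \<in> edges H" "e' \<in> edges H" "e \<noteq> e'" for e e'
  proof -
    have "inner_verts (P e) \<inter> inner_verts (P e') = {}" using via that by (simp add: subdivision_via_def)
    then show ?thesis using inner(1) that by simp
  qed
  have out: "m e \<notin> \<phi> ` verts H" if "e \<in> edges H" for e
  proof -
    have "inner_verts (P e) \<inter> \<phi> ` verts H = {}" using via that by (simp add: subdivision_via_def)
    then show ?thesis using inner(1)[OF that] by simp
  qed
  have injm: "inj_on m (edges H)" using disj by (auto simp: inj_on_def)
  have "verts S = \<phi> ` verts H \<union> (\<Union>e\<in>edges H. set (P e))" using via by (simp add: subdivision_via_def)
  moreover have "verts S \<subseteq> {..<f}" using S by (simp add: is_subgraph_def complete_graph_def)
  ultimately have "\<phi> ` verts H \<union> m ` edges H \<subseteq> {..<f}" using inner(2) by blast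
  then have "card (\<phi> ` verts H \<union> m ` edges H) \<le> f" using card_mono[of "{..<f}"] by fastforce
  moreover have "card (\<phi> ` verts H \<union> m ` edges H) = card (\<phi> ` verts H) + card (m ` edges H)"
  proof (rule card_Un_disjoint)
    show "\<phi> ` verts H \<inter> m ` edges H = {}"
    proof (rule equals0I)
      fix x assume x: "x \<in> \<phi> ` verts H \<inter> m ` edges H"
      then obtain e where "e \<in> edges H" "x = m e" by (metis IntD2 imageE)
      then show False using out[of e] x by simp
    qed
  qed (use finV finE in simp_all)
  ultimately show ?thesis by (simp add: card_image inj injm)
qed

lemma s_div_eq_order_of_subdivision:
  assumes H: "simple_graph H" and m: "m = card (verts H) + card (edges H)"
    and emb: "\<And>c :: nat \<Rightarrow> nat \<Rightarrow> bool. symp c \<Longrightarrow>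
      \<exists>\<phi> \<mu>. mono_embedding c (verts H) (edges H) {..<m} \<phi> \<mu>"
  shows "s_div 2 H 1 = m"
  unfolding s_div_def
proof (rule cInf_eq_minimum)
  have "has_divisible_subdivision 2 1 H (complete_graph m) \<omega>"
    if \<omega>: "edge_weighting 2 (complete_graph m) \<omega>" for \<omega>
  proof -
    have "symp (\<lambda>x y. \<omega> {x, y} = 0)" by (auto intro!: sympI simp: insert_commute)
    from emb[OF this] obtain \<phi> \<mu>
      where "mono_embedding (\<lambda>x y. \<omega> {x, y} = 0) (verts H) (edges H) {..<m} \<phi> \<mu>" by blast
    then show ?thesis by (rule divisible_subdivision_from_embedding[OF H \<omega>])
  qed
  then show "m \<in> {f. \<forall>\<omega>. edge_weighting 2 (complete_graph f) \<omega> \<longrightarrow>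
      has_divisible_subdivision 2 1 H (complete_graph f) \<omega>}" by blast
next
  fix f assume "f \<in> {f. \<forall>\<omega>. edge_weighting 2 (complete_graph f) \<omega> \<longrightarrow>
      has_divisible_subdivision 2 1 H (complete_graph f) \<omega>}"
  moreover have "edge_weighting 2 (complete_graph f) (\<lambda>_. 0)" by (simp add: edge_weighting_def)
  ultimately have "has_divisible_subdivision 2 1 H (complete_graph f) (\<lambda>_. 0)" by blast
  then show "m \<le> f" unfolding m by (rule card_le_of_divisible_subdivision[OF H])
qed

lemma s_div_tree:
  assumes "is_tree T"
  shows "s_div 2 T 1 = 2 * card (verts T) - 1"
proof -
  have T: "tree_on (verts T) (edges T)" using assms by (rule is_tree_imp_tree_on)
  have E: "card (verts T) = Suc (card (edges T))" using tree_on_card_edges[OF T] by simp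
  show ?thesis
  proof (rule s_div_eq_order_of_subdivision)
    show "simple_graph T" using assms by (simp add: is_tree_def)
    show "2 * card (verts T) - 1 = card (verts T) + card (edges T)" using E by simp
    show "\<exists>\<phi> \<mu>. mono_embedding c (verts T) (edges T) {..<2 * card (verts T) - 1} \<phi> \<mu>"
      if "symp c" for c :: "nat \<Rightarrow> nat \<Rightarrow> bool"
      by (rule subdivided_tree_embeds[OF that T]) simp_all
  qed
qed

text \<open>
  The hypothesis on the length matters for injectivity: in a cyclic sequence of two vertices, both
  indices give the same edge.
\<close>

lemma cycle_edges_enumeration:
  assumes "distinct p" "3 \<le> length p"
  shows "insert {last p, hd p} (path_edges p) =
      (\<lambda>i. {p ! i, p ! (Suc i mod length p)}) ` {..<length p}" (is "_ = ?ed ` _")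
    and "inj_on (\<lambda>i. {p ! i, p ! (Suc i mod length p)}) {..<length p}"
proof -
  let ?n = "length p"
  have "p \<noteq> []" using assms(2) by auto
  have dom: "{..<?n} = insert (?n - 1) {i. Suc i < ?n}" using assms(2) by auto
  have "?ed (?n - 1) = {last p, hd p}"
    using \<open>p \<noteq> []\<close> assms(2) by (simp add: last_conv_nth hd_conv_nth)
  moreover have "?ed ` {i. Suc i < ?n} = path_edges p"
    unfolding path_edges_def by auto
  ultimately show "insert {last p, hd p} (path_edges p) = ?ed ` {..<?n}"
    unfolding dom image_insert by simp
  show "inj_on ?ed {..<?n}"
  proof (rule inj_onI)
    fix i j assume ij: "i \<in> {..<?n}" "j \<in> {..<?n}" "?ed i = ?ed j"
    have nth: "p ! x = p ! y \<longleftrightarrow> x = y" if "x < ?n" "y < ?n" for x y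
      using assms(1) that by (simp add: nth_eq_iff_index_eq)
    have "Suc i mod ?n < ?n" "Suc j mod ?n < ?n" using \<open>p \<noteq> []\<close> by simp_all
    then have "i = j \<or> (i = Suc j mod ?n \<and> Suc i mod ?n = j)"
      using ij nth by (auto simp: doubleton_eq_iff)
    moreover have "\<not> (i = Suc j mod ?n \<and> Suc i mod ?n = j)"
      using ij(1,2) assms(2) by (auto simp: mod_Suc split: if_splits)
    ultimately show "i = j" by blast
  qed
qed

lemma s_div_cycle:
  assumes "is_cycle C"
  shows "s_div 2 C 1 = 2 * card (verts C)"
proof -
  obtain p where p: "distinct p" "3 \<le> length p" "verts C = set p"
      "edges C = insert {last p, hd p} (path_edges p)"
    using assms unfolding is_cycle_def by blast
  let ?n = "length p"
  let ?ed = "\<lambda>i. {p ! i, p ! (Suc i mod ?n)}"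
  have "p \<noteq> []" using p(2) by auto
  have E: "edges C = ?ed ` {..<?n}" and inj: "inj_on ?ed {..<?n}"
    using cycle_edges_enumeration[OF p(1,2)] p(4) by simp_all
  have nth_inj: "inj_on ((!) p) {..<?n}" using p(1) by (auto simp: inj_on_def nth_eq_iff_index_eq)
  have V: "verts C = (!) p ` {..<?n}" unfolding p(3) set_conv_nth by auto
  have succ_lt: "Suc i mod ?n < ?n" for i using \<open>p \<noteq> []\<close> by simp
  have index: "\<exists>i<?n. e = ?ed i" if "e \<in> edges C" for e using that unfolding E by auto
  have cardV: "card (verts C) = ?n" using p(1,3) by (simp add: distinct_card)
  have cardE: "card (edges C) = ?n" unfolding E by (simp add: card_image inj)
  show ?thesis
  proof (rule s_div_eq_order_of_subdivision)
    have "e \<subseteq> verts C \<and> card e = 2" if e: "e \<in> edges C" for e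
    proof -
      obtain i where i: "i < ?n" "e = ?ed i" using index[OF e] by blast
      have "Suc i mod ?n \<noteq> i" using i(1) p(2) by (auto simp: mod_Suc split: if_splits)
      then have "p ! i \<noteq> p ! (Suc i mod ?n)"
        using p(1) i(1) succ_lt[of i] by (simp add: nth_eq_iff_index_eq)
      then show ?thesis using i succ_lt[of i] p(3) by simp
    qed
    then show "simple_graph C" using p(3) by (simp add: simple_graph_def)
    show "2 * card (verts C) = card (verts C) + card (edges C)" using cardV cardE by simp
    fix c :: "nat \<Rightarrow> nat \<Rightarrow> bool" assume "symp c"
    then obtain f g where fg: "alternating_cycle c ?n {..<2 * ?n} f g"
      using subdivided_cycle_embeds[of c "{..<2 * ?n}" ?n] p(2) by auto
    define \<phi> where "\<phi> = f \<circ> the_inv_into {..<?n} ((!) p)"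
    define \<mu> where "\<mu> = g \<circ> the_inv_into {..<?n} ?ed"
    have \<phi>: "\<phi> (p ! i) = f i" if "i < ?n" for i
      using the_inv_into_f_f[OF nth_inj, of i] that by (simp add: \<phi>_def)
    have \<mu>: "\<mu> (?ed i) = g i" if "i < ?n" for i
      using the_inv_into_f_f[OF inj, of i] that by (simp add: \<mu>_def)
    have im: "\<phi> ` verts C = f ` {..<?n}" "\<mu> ` edges C = g ` {..<?n}"
      unfolding V E image_image using \<phi> \<mu> by (auto intro!: image_cong)
    have "inj_on \<phi> (verts C)"
      using fg \<phi> unfolding V alternating_cycle_def inj_on_def by auto
    moreover have "inj_on \<mu> (edges C)"
    proof (rule inj_onI)
      fix e e' assume "e \<in> edges C" "e' \<in> edges C" and eq: "\<mu> e = \<mu> e'"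
      then obtain i j where ij: "i < ?n" "e = ?ed i" "j < ?n" "e' = ?ed j" unfolding E by auto
      then have "g i = g j" using eq \<mu> by simp
      then have "i = j" using fg ij(1,3) by (auto simp: alternating_cycle_def inj_on_def)
      then show "e = e'" using ij by simp
    qed
    moreover have "c (\<mu> e) (\<phi> u) = c (\<mu> e) (\<phi> v)"
      if e: "e \<in> edges C" and uv: "u \<in> e" "v \<in> e" for e u v
    proof -
      obtain i where i: "i < ?n" "e = ?ed i" using index[OF e] by blast
      have "c (g i) (f i) = c (g i) (f (Suc i mod ?n))" using fg i(1) by (simp add: alternating_cycle_def)
      then show ?thesis using uv i \<mu>[OF i(1)] \<phi>[OF i(1)] \<phi>[OF succ_lt[of i]] by auto
    qed
    moreover have "f ` {..<?n} \<inter> g ` {..<?n} = {}" "f ` {..<?n} \<union> g ` {..<?n} \<subseteq> {..<2 * ?n}"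
      using fg by (simp_all add: alternating_cycle_def)
    ultimately have "mono_embedding c (verts C) (edges C) {..<2 * card (verts C)} \<phi> \<mu>"
      unfolding mono_embedding_def im cardV by (intro conjI ballI)
    then show "\<exists>\<phi> \<mu>. mono_embedding c (verts C) (edges C) {..<2 * card (verts C)} \<phi> \<mu>"
      by (intro exI)
  qed
qed

theorem theorem1p8:
  shows "(\<forall>(T :: 'a ugraph) n. is_tree T \<and> card (verts T) = n \<longrightarrow> s_div 2 T 1 = 2 * n - 1) \<and>
         (\<forall>(C :: 'a ugraph) n. is_cycle C \<and> card (verts C) = n \<longrightarrow> s_div 2 C 1 = 2 * n)"
  using s_div_tree s_div_cycle by blast

end
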